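(* Let $H$ be one of the following graphs: $4K_1$, the co-diamond, the co-claw. Then for every integer $p\ge 1$ there exist a positive integer $k$ and a $k$-colorable $(2K_2, H)$-free graph $G$ that is not $(k+p)$-mixing.
   Context: All graphs are finite and simple. A $k$-coloring of $G$ is a map $V(G)\to\{1,\dots,k\}$ giving adjacent vertices different values; $G$ is $k$-colorable if it has a $k$-coloring. $R_k(G)$ denotes the graph whose vertices are the $k$-colorings of $G$, two being adjacent if they differ in color on exactly one vertex. $G$ is $\ell$-mixing if $R_\ell(G)$ is connected. A graph is $(H_1,\dots,H_r)$-free if it has no induced subgraph isomorphic to any $H_i$. $2K_2$ is the disjoint union of two edges; $4K_1$ is the edgeless graph on 4 vertices; the co-diamond is $K_2+2K_1$ (4 vertices, one edge); the co-claw is $K_3+K_1$ (disjoint union of a triangle and a single vertex). *)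

theory Defs
  imports "Graph_Theory.Graph_Theory" "HOL-Library.FuncSet"
begin

text \<open>
  A finite simple graph is a \<^term>\<open>G\<close> with \<^prop>\<open>pair_graph G\<close>: a finite loop-free digraph
  without parallel arcs whose arc relation is symmetric, each edge being the two arcs
  in opposite directions.
\<close>

definition graph_of_edges :: "'a set \<Rightarrow> 'a rel \<Rightarrow> 'a pair_pre_digraph" where
  "graph_of_edges V E = \<lparr> pverts = V, parcs = E \<union> E\<inverse> \<rparr>"

definition two_K2 :: "nat pair_pre_digraph" where
  "two_K2 = graph_of_edges {0, 1, 2, 3} {(0, 1), (2, 3)}"

definition four_K1 :: "nat pair_pre_digraph" where
  "four_K1 = graph_of_edges {0, 1, 2, 3} {}"

definition co_diamond :: "nat pair_pre_digraph" where
  "co_diamond = graph_of_edges {0, 1, 2, 3} {(0, 1)}"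

definition co_claw :: "nat pair_pre_digraph" where
  "co_claw = graph_of_edges {0, 1, 2, 3} {(0, 1), (1, 2), (0, 2)}"

definition induced_free :: "'b pair_pre_digraph set \<Rightarrow> 'a pair_pre_digraph \<Rightarrow> bool" where
  "induced_free \<H> G \<longleftrightarrow>
     (\<forall>H\<in>\<H>. \<not> (\<exists>F. induced_subgraph F (with_proj G) \<and> digraph_iso F (with_proj H)))"

text \<open>
  The extensional function space makes two colorings equal as soon as they agree on
  the vertices of the graph.
\<close>

definition colorings :: "nat \<Rightarrow> 'a pair_pre_digraph \<Rightarrow> ('a \<Rightarrow> nat) set" where
  "colorings k G = {c \<in> pverts G \<rightarrow>\<^sub>E {1..k}. \<forall>(u, v) \<in> parcs G. c u \<noteq> c v}"

definition colorable :: "nat \<Rightarrow> 'a pair_pre_digraph \<Rightarrow> bool" where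
  "colorable k G \<longleftrightarrow> (\<exists>c. c \<in> colorings k G)"

definition recoloring_graph :: "nat \<Rightarrow> 'a pair_pre_digraph \<Rightarrow> ('a \<Rightarrow> nat) pair_pre_digraph" where
  "recoloring_graph k G =
     \<lparr> pverts = colorings k G,
       parcs = {(c, d). c \<in> colorings k G \<and> d \<in> colorings k G \<and> (\<exists>!v. v \<in> pverts G \<and> c v \<noteq> d v)} \<rparr>"

definition mixing :: "nat \<Rightarrow> 'a pair_pre_digraph \<Rightarrow> bool" where
  "mixing l G \<longleftrightarrow> Digraph_Component.connected (with_proj (recoloring_graph l G))"

lemma pair_graph_graph_of_edges:
  assumes "finite V" "E \<subseteq> V \<times> V" "irrefl E"
  shows "pair_graph (graph_of_edges V E)"
proof -
  have "finite E" using assms(1,2) by (meson finite_SigmaI finite_subset)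
  then show ?thesis
    using assms
    by unfold_locales
      (auto simp: graph_of_edges_def symmetric_def irrefl_def intro: symI)
qed

lemma pair_graph_forbidden:
  "pair_graph two_K2" "pair_graph four_K1" "pair_graph co_diamond" "pair_graph co_claw"
  unfolding two_K2_def four_K1_def co_diamond_def co_claw_def
  by (rule pair_graph_graph_of_edges; auto simp: irrefl_def)+

lemma pair_graph_recoloring_graph:
  assumes "finite (pverts G)"
  shows "pair_graph (recoloring_graph k G)"
proof -
  have fin: "finite (colorings k G)"
    by (rule finite_subset[of _ "pverts G \<rightarrow>\<^sub>E {1..k}"])
      (use assms in \<open>auto simp: colorings_def intro!: finite_PiE\<close>)
  have "parcs (recoloring_graph k G) \<subseteq> colorings k G \<times> colorings k G"
    by (auto simp: recoloring_graph_def)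
  with fin have "finite (parcs (recoloring_graph k G))"
    by (meson finite_SigmaI finite_subset)
  with fin show ?thesis
    by unfold_locales
      (auto simp: recoloring_graph_def symmetric_def sym_def eq_commute)
qed

end

theory Submission
  imports Defs
begin

text \<open>
  If every vertex of \<open>G\<close> sees all the other \<open>l\<close> - 1 colors in some \<open>l\<close>-coloring, then this coloring
  is isolated in the recoloring graph. Let \<open>B\<close> be the disjoint union of \<open>p\<close> truncated tetrahedra,
  that is of \<open>p\<close> copies of \<open>K\<^sub>4\<close> with each vertex blown up to a triangle, and let \<open>G\<close> be the
  complement of \<open>B\<close>. The \<open>4p\<close> triangles of \<open>B\<close> are the classes of a \<open>4p\<close>-coloring of \<open>G\<close>, so \<open>G\<close> is
  \<open>5p\<close>-colorable; the \<open>6p\<close> remaining edges of \<open>B\<close> form a perfect matching, and they are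
  the classes of an isolated \<open>6p\<close>-coloring, since no edge of this matching lies in a triangle.
  Finally \<open>B\<close> is the line graph of the subdivision of \<open>p\<close> copies of \<open>K\<^sub>4\<close>, whence it has no induced
  \<open>C\<^sub>4\<close>, \<open>K\<^sub>4\<close>, diamond or claw.
\<close>

section \<open>Induced subgraphs and isolated colorings\<close>

lemma induced_embedding:
  assumes "induced_subgraph F (with_proj G)" "digraph_iso F (with_proj H)"
  obtains f where "inj_on f (pverts H)" "f ` pverts H \<subseteq> pverts G"
    "\<And>u v. u \<in> pverts H \<Longrightarrow> v \<in> pverts H \<Longrightarrow> (u, v) \<in> parcs H \<longleftrightarrow> (f u, f v) \<in> parcs G"
proof -
  have sub: "verts F \<subseteq> pverts G" and tl: "tail F = fst" and hd: "head F = snd"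
    and arcsF: "arcs F = {a \<in> parcs G. fst a \<in> verts F \<and> snd a \<in> verts F}"
    using assms(1) by (auto simp: induced_subgraph_def subgraph_def compatible_def)
  \<comment> \<open>\<open>F\<close> inherits the projections as tail and head, so each arc is its
    own pair of ends.\<close>
  have endsF: "arcs_ends F = arcs F"
    by (auto simp: arcs_ends_def arc_to_ends_def tl hd)
  have "wf_digraph F"
    using assms(2) by (auto simp: digraph_iso_def pre_digraph.digraph_isomorphism_def)
  then have "digraph_iso (with_proj H) F"
    using assms(2) by (simp add: digraph_iso_swap)
  then obtain h where h: "pre_digraph.digraph_isomorphism (with_proj H) h"
    and F: "F = app_iso h (with_proj H)"
    by (auto simp: digraph_iso_def)
  let ?f = "iso_verts h"
  have wfH: "wf_digraph (with_proj H)" and inj: "inj_on ?f (pverts H)"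
    using h by (auto simp: pre_digraph.digraph_isomorphism_def)
  have vF: "verts F = ?f ` pverts H"
    by (simp add: F)
  have eF: "arcs F = (\<lambda>(u, v). (?f u, ?f v)) ` parcs H"
    using wf_digraph.arcs_ends_app_iso_eq[OF wfH h] by (simp add: endsF flip: F)
  have inH: "u \<in> pverts H \<and> v \<in> pverts H" if "(u, v) \<in> parcs H" for u v
    using wf_digraph.tail_in_verts[OF wfH, of "(u, v)"] wf_digraph.head_in_verts[OF wfH, of "(u, v)"]
      that by simp
  show thesis
  proof (rule that[of ?f])
    fix u v assume uv: "u \<in> pverts H" "v \<in> pverts H"
    have "(u, v) \<in> parcs H \<longleftrightarrow> (?f u, ?f v) \<in> arcs F"
    proof
      assume "(?f u, ?f v) \<in> arcs F"
      then obtain u' v' where *: "(u', v') \<in> parcs H" "?f u = ?f u'" "?f v = ?f v'"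
        by (auto simp: eF)
      then show "(u, v) \<in> parcs H"
        using inH[OF *(1)] uv inj_onD[OF inj] by metis
    qed (auto simp: eF)
    also have "\<dots> \<longleftrightarrow> (?f u, ?f v) \<in> parcs G"
      using uv by (auto simp: arcsF vF)
    finally show "(u, v) \<in> parcs H \<longleftrightarrow> (?f u, ?f v) \<in> parcs G" .
  qed (use inj sub vF in auto)
qed

lemma induced_embedding_four:
  fixes H :: "nat pair_pre_digraph"
  assumes "induced_subgraph F (with_proj G)" "digraph_iso F (with_proj H)" "pverts H = {0, 1, 2, 3}"
  obtains a b c d where "{a, b, c, d} \<subseteq> pverts G" "distinct [a, b, c, d]"
    "(0, 1) \<in> parcs H \<longleftrightarrow> (a, b) \<in> parcs G" "(0, 2) \<in> parcs H \<longleftrightarrow> (a, c) \<in> parcs G"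
    "(0, 3) \<in> parcs H \<longleftrightarrow> (a, d) \<in> parcs G" "(1, 2) \<in> parcs H \<longleftrightarrow> (b, c) \<in> parcs G"
    "(1, 3) \<in> parcs H \<longleftrightarrow> (b, d) \<in> parcs G" "(2, 3) \<in> parcs H \<longleftrightarrow> (c, d) \<in> parcs G"
proof -
  obtain f where f: "inj_on f (pverts H)" "f ` pverts H \<subseteq> pverts G"
    "\<And>u v. u \<in> pverts H \<Longrightarrow> v \<in> pverts H \<Longrightarrow> (u, v) \<in> parcs H \<longleftrightarrow> (f u, f v) \<in> parcs G"
    using induced_embedding[OF assms(1,2)] by blast
  have "distinct [f 0, f 1, f 2, f 3]"
    using f(1) by (simp add: assms(3) inj_on_eq_iff)
  then show thesis
    by (intro that[of "f 0" "f 1" "f 2" "f 3"] f(3)) (use f(2) in \<open>simp_all add: assms(3)\<close>)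
qed

text \<open>Recoloring \<open>v\<close> with \<open>q\<close> would clash with a neighbor that has
  color \<open>q\<close>, so no step leaves \<open>c\<close>, and \<open>d\<close> is out of
  reach.\<close>

lemma isolated_coloring_not_mixing:
  assumes c: "c \<in> colorings l G" and d: "d \<in> colorings l G" and "c \<noteq> d"
    and frozen: "\<And>v q. v \<in> pverts G \<Longrightarrow> q \<in> {1..l} \<Longrightarrow> q \<noteq> c v \<Longrightarrow> \<exists>w. (v, w) \<in> parcs G \<and> c w = q"
    and loopfree: "\<And>v. (v, v) \<notin> parcs G"
  shows "\<not> mixing l G"
proof
  let ?R = "recoloring_graph l G"
  have isolated: False
    if c': "c' \<in> colorings l G" and ex: "\<exists>!v. v \<in> pverts G \<and> c v \<noteq> c' v" for c'
  proof -
    from ex obtain v where v: "v \<in> pverts G" "c v \<noteq> c' v"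
      and uniq: "\<And>w. w \<in> pverts G \<Longrightarrow> c w \<noteq> c' w \<Longrightarrow> w = v"
      by (elim ex1E) blast
    have "c' v \<in> {1..l}"
      using c' v(1) by (auto simp: colorings_def PiE_def Pi_def)
    then obtain w where w: "(v, w) \<in> parcs G" "c w = c' v"
      using frozen[of v "c' v"] v by auto
    have "c' v \<noteq> c' w"
      using c' w(1) by (auto simp: colorings_def)
    have "w \<noteq> v"
      using w(1) loopfree by auto
    \<comment> \<open>\<open>frozen\<close> does not place \<open>w\<close> in \<open>G\<close>;
      outside \<open>G\<close> both colorings are \<open>undefined\<close> by
      extensionality.\<close>
    have "c w = c' w"
    proof (cases "w \<in> pverts G")
      case False
      then show ?thesis
        using c c' by (auto simp: colorings_def PiE_def extensional_def)
    qed (use uniq \<open>w \<noteq> v\<close> in blast)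
    with w(2) \<open>c' v \<noteq> c' w\<close> show False
      by simp
  qed
  \<comment> \<open>Connectivity refers to the symmetric closure, so arcs into \<open>c\<close> are
    excluded as well.\<close>
  have no_arc: "(c, c') \<notin> parcs (mk_symmetric (with_proj ?R))" for c'
  proof
    have "c' v \<noteq> c v \<longleftrightarrow> c v \<noteq> c' v" for v
      by auto
    moreover assume "(c, c') \<in> parcs (mk_symmetric (with_proj ?R))"
    ultimately show False
      using isolated[of c']
      by (simp add: parcs_mk_symmetric recoloring_graph_def split: prod.splits) metis
  qed
  assume "mixing l G"
  then have "(c, d) \<in> rtrancl_on (colorings l G) (parcs (mk_symmetric (with_proj ?R)))"
    using c d by (auto simp: mixing_def connected_def strongly_connected_def reachable_def
        recoloring_graph_def)
  then have "d = c"
    by (induction rule: rtrancl_on_induct) (use no_arc in auto)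
  with \<open>c \<noteq> d\<close> show False
    by simp
qed

section \<open>Complements of line graphs of subdivisions\<close>

text \<open>
  The elements of \<open>V\<close> are the half-edges of a simple graph of maximum degree at most 3:
  \<open>t x\<close> is the vertex and \<open>e x\<close> the edge to which the half-edge \<open>x\<close> belongs.
\<close>

locale half_edges =
  fixes V :: "'a set" and t e :: "'a \<Rightarrow> nat"
  assumes finite_V: "finite V"
    and loopless: "x \<in> V \<Longrightarrow> y \<in> V \<Longrightarrow> t x = t y \<Longrightarrow> e x = e y \<Longrightarrow> x = y"
    and edge_size: "{x, y, z} \<subseteq> V \<Longrightarrow> e x = e y \<Longrightarrow> e y = e z \<Longrightarrow> \<not> distinct [x, y, z]"
    and degree: "{x, y, z, w} \<subseteq> V \<Longrightarrow> t x = t y \<Longrightarrow> t y = t z \<Longrightarrow> t z = t w \<Longrightarrow> \<not> distinct [x, y, z, w]"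
    and no_parallel: "{a, b, c, d} \<subseteq> V \<Longrightarrow> t a = t c \<Longrightarrow> e c = e b \<Longrightarrow> t b = t d \<Longrightarrow> e d = e a \<Longrightarrow>
      a = c \<or> b = c"
begin

text \<open>A half-edge \<open>x\<close> is the edge of the subdivision with ends \<open>t x\<close>
  and \<open>e x\<close>; two are nonadjacent here iff they share an end.\<close>

definition colinegraph :: "'a pair_pre_digraph" where
  "colinegraph = \<lparr> pverts = V, parcs = {(x, y). x \<in> V \<and> y \<in> V \<and> t x \<noteq> t y \<and> e x \<noteq> e y} \<rparr>"

lemma pverts_colinegraph [simp]: "pverts colinegraph = V"
  by (simp add: colinegraph_def)

lemma arc_iff [simp]: "(x, y) \<in> parcs colinegraph \<longleftrightarrow> x \<in> V \<and> y \<in> V \<and> t x \<noteq> t y \<and> e x \<noteq> e y"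
  by (simp add: colinegraph_def)

lemma pair_graph_colinegraph: "pair_graph colinegraph"
proof -
  have "finite (parcs colinegraph)"
    by (rule finite_subset[of _ "V \<times> V"]) (use finite_V in auto)
  then show ?thesis
    using finite_V by unfold_locales (auto simp: symmetric_def sym_def)
qed

text \<open>Two of the three pairs agree in the same one of \<open>t\<close> and \<open>e\<close>,
  hence by transitivity all three do; \<open>edge_size\<close> excludes \<open>e\<close>.\<close>

lemma triangle:
  assumes "{a, b, c} \<subseteq> V" "distinct [a, b, c]"
    "t a = t b \<or> e a = e b" "t a = t c \<or> e a = e c" "t b = t c \<or> e b = e c"
  shows "t a = t b \<and> t b = t c"
proof -
  have "\<not> (e a = e b \<and> e b = e c)"
    using assms(1,2) edge_size[of a b c] by blast
  moreover have "\<not> (t a = t b \<and> e a = e b)" "\<not> (t a = t c \<and> e a = e c)" "\<not> (t b = t c \<and> e b = e c)"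
    using assms(1,2) loopless[of a b] loopless[of a c] loopless[of b c] by auto
  ultimately show ?thesis
    using assms(3-5) by metis
qed

text \<open>Around the cycle a, c, b, d the agreements must alternate between \<open>t\<close> and
  \<open>e\<close>, as two consecutive ones of the same kind would carry over to a diagonal.
  Alternation yields two parallel edges.\<close>

lemma two_K2_free:
  assumes "{a, b, c, d} \<subseteq> V" "t a \<noteq> t b" "e a \<noteq> e b" "t c \<noteq> t d" "e c \<noteq> e d"
    "t a = t c \<or> e a = e c" "t a = t d \<or> e a = e d" "t b = t c \<or> e b = e c" "t b = t d \<or> e b = e d"
  shows False
proof -
  have "a = c \<or> b = c" if "t a = t c" "e c = e b" "t b = t d" "e d = e a"
    using no_parallel[of a b c d] assms(1) that by blast
  moreover have "a = d \<or> b = d" if "t a = t d" "e d = e b" "t b = t c" "e c = e a"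
    using no_parallel[of a b d c] assms(1) that by blast
  ultimately show False
    using assms(2-) by metis
qed

text \<open>Two overlapping triangles put four half-edges at one vertex.\<close>

lemma four_K1_free:
  assumes "{a, b, c, d} \<subseteq> V" "distinct [a, b, c, d]"
    "t a = t b \<or> e a = e b" "t a = t c \<or> e a = e c" "t a = t d \<or> e a = e d"
    "t b = t c \<or> e b = e c" "t b = t d \<or> e b = e d" "t c = t d \<or> e c = e d"
  shows False
proof -
  have "t a = t b \<and> t b = t c"
    by (rule triangle) (use assms in simp_all)
  moreover have "t b = t c \<and> t c = t d"
    by (rule triangle) (use assms in simp_all)
  ultimately show False
    using degree[of a b c d] assms(1,2) by metis
qed

text \<open>The triangles a, c, d and b, c, d lie at the same vertex, which forces
  \<open>t a = t b\<close>.\<close>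

lemma co_diamond_free:
  assumes "{a, b, c, d} \<subseteq> V" "distinct [a, b, c, d]" "t a \<noteq> t b" "e a \<noteq> e b"
    "t a = t c \<or> e a = e c" "t a = t d \<or> e a = e d"
    "t b = t c \<or> e b = e c" "t b = t d \<or> e b = e d" "t c = t d \<or> e c = e d"
  shows False
proof -
  have "t a = t c \<and> t c = t d"
    by (rule triangle) (use assms in simp_all)
  moreover have "t b = t c \<and> t c = t d"
    by (rule triangle) (use assms in simp_all)
  ultimately show False
    using assms(3) by metis
qed

lemma induced_free_colinegraph:
  assumes "H \<in> {four_K1, co_diamond, co_claw}"
  shows "induced_free {two_K2, H} colinegraph"
  unfolding induced_free_def
proof (intro ballI notI; elim exE conjE)
  fix K F
  assume K: "K \<in> {two_K2, H}" and F: "induced_subgraph F (with_proj colinegraph)"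
    "digraph_iso F (with_proj K)"
  have "pverts K = {0, 1, 2, 3}"
    using K assms
    by (auto simp: two_K2_def four_K1_def co_diamond_def co_claw_def graph_of_edges_def)
  from induced_embedding_four[OF F this] obtain a b c d
    where abcd: "{a, b, c, d} \<subseteq> V" "distinct [a, b, c, d]"
      and arcs: "(0, 1) \<in> parcs K \<longleftrightarrow> t a \<noteq> t b \<and> e a \<noteq> e b"
        "(0, 2) \<in> parcs K \<longleftrightarrow> t a \<noteq> t c \<and> e a \<noteq> e c"
        "(0, 3) \<in> parcs K \<longleftrightarrow> t a \<noteq> t d \<and> e a \<noteq> e d"
        "(1, 2) \<in> parcs K \<longleftrightarrow> t b \<noteq> t c \<and> e b \<noteq> e c"
        "(1, 3) \<in> parcs K \<longleftrightarrow> t b \<noteq> t d \<and> e b \<noteq> e d"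
        "(2, 3) \<in> parcs K \<longleftrightarrow> t c \<noteq> t d \<and> e c \<noteq> e d"
    by (simp add: insert_subset) blast
  consider "K = two_K2" | "K = four_K1" | "K = co_diamond" | "K = co_claw"
    using K assms by blast
  then show False
  proof cases
    case 1
    show False
      by (rule two_K2_free[OF abcd(1)]) (use arcs in \<open>simp_all add: 1 two_K2_def graph_of_edges_def\<close>)
  next
    case 2
    show False
      by (rule four_K1_free[OF abcd]) (use arcs in \<open>simp_all add: 2 four_K1_def graph_of_edges_def\<close>)
  next
    case 3
    show False
      by (rule co_diamond_free[OF abcd])
        (use arcs in \<open>simp_all add: 3 co_diamond_def graph_of_edges_def\<close>)
  next
    case 4
    \<comment> \<open>By pigeonhole, \<open>d\<close> agrees with two of \<open>a\<close>,
      \<open>b\<close>, \<open>c\<close> in the same one of \<open>t\<close> and \<open>e\<close>,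
      so these two are nonadjacent.\<close>
    then show False
      using arcs by (simp add: co_claw_def graph_of_edges_def) metis
  qed
qed

lemma vertex_coloring:
  assumes "t ` V \<subseteq> {..<k}"
  shows "(\<lambda>x\<in>V. Suc (t x)) \<in> colorings k colinegraph"
  using assms by (auto simp: colorings_def)

text \<open>Color by \<open>e\<close>. Each class contains two half-edges at different vertices, so
  any \<open>v\<close> of another class is adjacent to at least one of them. Coloring by
  \<open>t\<close> supplies the second coloring.\<close>

lemma not_mixing:
  assumes "V \<noteq> {}" "t ` V \<subseteq> {..<k}" "e ` V \<subseteq> {..<l}" "k \<le> l"
    and full: "\<And>q. q < l \<Longrightarrow> \<exists>x\<in>V. \<exists>y\<in>V. x \<noteq> y \<and> e x = q \<and> e y = q"
  shows "\<not> mixing l colinegraph"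
proof (rule isolated_coloring_not_mixing)
  let ?c = "\<lambda>x\<in>V. Suc (e x)" and ?d = "\<lambda>x\<in>V. Suc (t x)"
  show "?c \<in> colorings l colinegraph"
    using assms(3) by (auto simp: colorings_def)
  show "?d \<in> colorings l colinegraph"
    by (rule vertex_coloring) (use assms(2,4) in auto)
  obtain x where x: "x \<in> V"
    using assms(1) by auto
  then obtain x' y' where xy: "x' \<in> V" "y' \<in> V" "x' \<noteq> y'" "e x' = e x" "e y' = e x"
    using full[of "e x"] assms(3) by auto
  show "?c \<noteq> ?d"
  proof
    assume *: "?c = ?d"
    have "e z = t z" if "z \<in> V" for z
      using fun_cong[OF *, of z] that by simp
    then show False
      using xy loopless[of x' y'] by simp
  qed
next
  fix v q
  assume v: "v \<in> pverts colinegraph" and q: "q \<in> {1..l}" "q \<noteq> (\<lambda>x\<in>V. Suc (e x)) v"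
  have "q - 1 < l"
    using q(1) by auto
  then obtain x y where xy: "x \<in> V" "y \<in> V" "x \<noteq> y" "e x = q - 1" "e y = q - 1"
    using full by blast
  then have "t x \<noteq> t y"
    using loopless by metis
  then obtain w where w: "w \<in> V" "e w = q - 1" "t v \<noteq> t w"
    using xy by metis
  then show "\<exists>w. (v, w) \<in> parcs colinegraph \<and> (\<lambda>x\<in>V. Suc (e x)) w = q"
    using v q by (intro exI[of _ w]) auto
qed simp

end

section \<open>Copies of the complete graph on four vertices\<close>

text \<open>
  Vertices, edges and half-edges of each copy of \<open>K\<^sub>4\<close> are numbered from 0 to 3, 5 and 11;
  half-edge \<open>s\<close> belongs to vertex \<open>s div 3\<close>.
\<close>

definition K4_edge :: "nat \<Rightarrow> nat" where
  "K4_edge s = [0, 1, 2, 0, 3, 4, 1, 3, 5, 2, 4, 5] ! s"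

text \<open>The other half of the same edge; with it, excluding parallel edges is a check over pairs
  instead of quadruples.\<close>

definition K4_opposite :: "nat \<Rightarrow> nat" where
  "K4_opposite s = [3, 6, 9, 0, 7, 10, 1, 4, 11, 2, 5, 8] ! s"

text \<open>Half-edge s of copy i is the number 12 i + s, so its vertex 4 i + s div 3 is just
  \<open>x div 3\<close>.\<close>

definition half_edge_edge :: "nat \<Rightarrow> nat" where
  "half_edge_edge x = 6 * (x div 12) + K4_edge (x mod 12)"

definition half_edge_opposite :: "nat \<Rightarrow> nat" where
  "half_edge_opposite x = 12 * (x div 12) + K4_opposite (x mod 12)"

lemma K4_edge_less: "K4_edge (x mod 12) < 6"
proof -
  have "\<forall>s\<in>{..<12}. K4_edge s < 6"
    by code_simp
  then show ?thesis
    by (rule bspec) simp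
qed

lemma K4_opposite_less: "K4_opposite (x mod 12) < 12"
proof -
  have "\<forall>s\<in>{..<12}. K4_opposite s < 12"
    by code_simp
  then show ?thesis
    by (rule bspec) simp
qed

lemma K4_edge_eq:
  "\<forall>r\<in>set [0..<12]. \<forall>s\<in>set [0..<12]. K4_edge r = K4_edge s \<longrightarrow> s = r \<or> s = K4_opposite r"
  by code_simp

lemma K4_loopless:
  "\<forall>r\<in>set [0..<12]. \<forall>s\<in>set [0..<12]. r div 3 = s div 3 \<and> K4_edge r = K4_edge s \<longrightarrow> r = s"
  by code_simp

lemma K4_no_parallel:
  "\<forall>r\<in>set [0..<12]. \<forall>s\<in>set [0..<12].
     r div 3 = s div 3 \<and> K4_opposite r div 3 = K4_opposite s div 3 \<longrightarrow> r = s"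
  by code_simp

lemma K4_edge_full:
  "\<forall>q\<in>set [0..<6]. \<exists>r\<in>set [0..<12]. \<exists>s\<in>set [0..<12]. r \<noteq> s \<and> K4_edge r = q \<and> K4_edge s = q"
  by code_simp

text \<open>Separates the copy from the position in it, which reduces claims about vertices to the
  finite tables.\<close>

lemma div3_eq_iff: "x div 3 = y div 3 \<longleftrightarrow> x div 12 = y div 12 \<and> x mod 12 div 3 = y mod 12 div 3"
  for x y :: nat
proof -
  have "z div 3 div 4 = z div 12" "z div 3 mod 4 = z mod 12 div 3" for z :: nat
    using div_mult2_eq[of z 3 4] mod_mult2_eq[of z 3 4] by simp_all
  then show ?thesis
    by (metis div_mult_mod_eq)
qed

lemma half_edge_edge_eq_iff:
  "half_edge_edge x = half_edge_edge y \<longleftrightarrow> x div 12 = y div 12 \<and> K4_edge (x mod 12) = K4_edge (y mod 12)"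
proof -
  have "half_edge_edge z div 6 = z div 12" "half_edge_edge z mod 6 = K4_edge (z mod 12)" for z
    using K4_edge_less[of z] by (simp_all add: half_edge_edge_def)
  then show ?thesis
    by (metis half_edge_edge_def)
qed

lemma half_edge_opposite_div_mod:
  "half_edge_opposite x div 12 = x div 12" "half_edge_opposite x mod 12 = K4_opposite (x mod 12)"
  using K4_opposite_less[of x] by (simp_all add: half_edge_opposite_def)

lemma eq_if_div_mod_eq: "x div 12 = y div 12 \<Longrightarrow> x mod 12 = y mod 12 \<Longrightarrow> x = y" for x y :: nat
  by (metis div_mult_mod_eq)

lemma half_edge_edge_eqD:
  assumes "half_edge_edge x = half_edge_edge y"
  shows "y = x \<or> y = half_edge_opposite x"
proof -
  have "y mod 12 = x mod 12 \<or> y mod 12 = K4_opposite (x mod 12)"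
    by (rule K4_edge_eq[rule_format]) (use assms in \<open>simp_all add: half_edge_edge_eq_iff\<close>)
  then show ?thesis
    using assms
    by (metis eq_if_div_mod_eq half_edge_edge_eq_iff half_edge_opposite_div_mod)
qed

lemma half_edge_loopless:
  assumes "x div 3 = y div 3" "half_edge_edge x = half_edge_edge y"
  shows "x = y"
proof (rule eq_if_div_mod_eq)
  show "x mod 12 = y mod 12"
    by (rule K4_loopless[rule_format])
      (use assms div3_eq_iff[of x y] in \<open>simp_all add: half_edge_edge_eq_iff\<close>)
qed (use assms in \<open>simp add: half_edge_edge_eq_iff\<close>)

lemma half_edge_no_parallel:
  assumes "x div 3 = y div 3" "half_edge_opposite x div 3 = half_edge_opposite y div 3"
  shows "x = y"
proof (rule eq_if_div_mod_eq)
  show "x mod 12 = y mod 12"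
    by (rule K4_no_parallel[rule_format])
      (use assms div3_eq_iff[of x y] div3_eq_iff[of "half_edge_opposite x" "half_edge_opposite y"]
        in \<open>simp_all add: half_edge_opposite_div_mod\<close>)
qed (use assms div3_eq_iff[of x y] in simp)

lemma half_edges_K4: "half_edges {..<12 * p} (\<lambda>x. x div 3) half_edge_edge"
proof
  fix x y z w :: nat
  show "x div 3 = y div 3 \<Longrightarrow> half_edge_edge x = half_edge_edge y \<Longrightarrow> x = y"
    by (rule half_edge_loopless)
  show "half_edge_edge x = half_edge_edge y \<Longrightarrow> half_edge_edge y = half_edge_edge z \<Longrightarrow>
      \<not> distinct [x, y, z]"
    using half_edge_edge_eqD[of x y] half_edge_edge_eqD[of x z] by auto
  assume *: "x div 3 = y div 3" "y div 3 = z div 3" "z div 3 = w div 3"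
  \<comment> \<open>Only three numbers share a quotient by 3, so four distinct ones cannot.\<close>
  have "u \<in> {3 * (x div 3), 3 * (x div 3) + 1, 3 * (x div 3) + 2}" if "u div 3 = x div 3" for u
    unfolding that[symmetric] insert_iff empty_iff by presburger
  from this[of x] this[of y] this[of z] this[of w] show "\<not> distinct [x, y, z, w]"
    using * by auto
next
  fix a b c d :: nat
  assume *: "a div 3 = c div 3" "half_edge_edge c = half_edge_edge b" "b div 3 = d div 3"
    "half_edge_edge d = half_edge_edge a"
  show "a = c \<or> b = c"
  proof (cases "b = half_edge_opposite c \<and> d = half_edge_opposite a")
    case True
    then show ?thesis
      using half_edge_no_parallel[of a c] *(1,3) by simp
  next
    case False
    then have "b = c \<or> d = a"
      using half_edge_edge_eqD *(2,4) by metis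
    \<comment> \<open>If \<open>d = a\<close>, then \<open>b\<close> and \<open>c\<close> share
      their vertex as well as their edge.\<close>
    then show ?thesis
      using half_edge_loopless[of b c] * by metis
  qed
qed simp

lemma half_edge_edge_full:
  assumes "q < 6 * p"
  shows "\<exists>x\<in>{..<12 * p}. \<exists>y\<in>{..<12 * p}. x \<noteq> y \<and> half_edge_edge x = q \<and> half_edge_edge y = q"
proof -
  obtain r s where rs: "r < 12" "s < 12" "r \<noteq> s" "K4_edge r = q mod 6" "K4_edge s = q mod 6"
    using bspec[OF K4_edge_full, of "q mod 6"] by auto
  have "q div 6 < p"
    using assms by (simp add: less_mult_imp_div_less mult.commute)
  then show ?thesis
    using rs by (intro bexI[of _ "12 * (q div 6) + r"] bexI[of _ "12 * (q div 6) + s"])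
      (auto simp: half_edge_edge_def)
qed

theorem theorem3:
  fixes H :: "nat pair_pre_digraph" and p :: nat
  assumes "H \<in> {four_K1, co_diamond, co_claw}" and "p \<ge> 1"
  shows "\<exists>(k :: nat) (G :: nat pair_pre_digraph).
           k > 0 \<and> pair_graph G \<and> colorable k G \<and> induced_free {two_K2, H} G \<and> \<not> mixing (k + p) G"
proof -
  interpret half_edges "{..<12 * p}" "\<lambda>x. x div 3" half_edge_edge
    by (rule half_edges_K4)
  \<comment> \<open>Only \<open>4 * p\<close> colors occur; the bound \<open>5 * p\<close> makes k +
    p equal to the number \<open>6 * p\<close> of edges.\<close>
  have t: "(\<lambda>x. x div 3) ` {..<12 * p} \<subseteq> {..<5 * p}"
    by auto
  have e: "half_edge_edge ` {..<12 * p} \<subseteq> {..<5 * p + p}"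
  proof clarsimp
    fix x assume "x < 12 * p"
    then have "x div 12 < p" "K4_edge (x mod 12) < 6"
      using K4_edge_less by (simp_all add: less_mult_imp_div_less mult.commute)
    then show "half_edge_edge x < 6 * p"
      unfolding half_edge_edge_def by linarith
  qed
  have "\<not> mixing (5 * p + p) colinegraph"
  proof (rule not_mixing[OF _ t e])
    show "{..<12 * p} \<noteq> {}"
      using assms(2) by (auto simp: lessThan_empty_iff)
  qed (use half_edge_edge_full[of _ p] in simp_all)
  moreover have "colorable (5 * p) colinegraph"
    unfolding colorable_def using vertex_coloring[OF t] by blast
  ultimately show ?thesis
    using assms induced_free_colinegraph pair_graph_colinegraph
    by (intro exI[of _ "5 * p"] exI[of _ colinegraph]) auto
qed

end
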